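(* Let $0 < e_2 < e_1 < 1$, let $U_1\equiv\langle T_1,e_1,S_1\rangle$ be a uninorm, and let $U_2\equiv\langle \min,e_2,S_2\rangle$ be a uninorm that is locally internal on $A(e_2)$. Then $U_1$ is distributive over $U_2$ if and only if the following three conditions all hold: (i) $U_1(x, y) = U_2(x, y) \in \{x, y\}$ for any $x \in [0, e_2[$ and $y \in [e_2, 1]$; and, in particular, $U_2(y_0,y_0)=y_0$ whenever $U_2(x_0,y_0)=y_0$ for some $x_0 \in [0, e_2[$ and $y_0 \in [e_1, 1]$. (ii) $U_1(x, y) = U_2(x, y) = \min(x, y)$ for any $x \in [0, e_2[$ and $y \in [e_2, e_1]$. (iii) There exists a uninorm $\widetilde{U}$ with neutral element $\frac{e_1-e_2}{1-e_2}$ such that, for any $x, y \in [e_2, 1]$, $$U_1(x,y) = e_2 + (1 - e_2)\, \widetilde{U}\left (\frac{x - e_2}{1 - e_2}, \frac{y - e_2}{1 - e_2}\right),$$ and $\widetilde{U}$ is distributive over $S_2$.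
   Context: A uninorm is a binary operation $U:[0,1]^2\to[0,1]$ that is commutative, associative, increasing (non-decreasing) in each variable with respect to the usual order, and has a neutral element $e\in[0,1]$. A uninorm is a t-norm if $e=1$ and a t-conorm if $e=0$. For $e\in\,]0,1[$, the notation $U\equiv\langle T,e,S\rangle$ means that $U$ is a uninorm with neutral element $e$, underlying t-norm $T$ and underlying t-conorm $S$, i.e. $T,S:[0,1]^2\to[0,1]$ are the t-norm and t-conorm with $U(x,y)=e\,T\left(\frac{x}{e},\frac{y}{e}\right)$ for $x,y\in[0,e]$ and $U(x,y)=e+(1-e)\,S\left(\frac{x-e}{1-e},\frac{y-e}{1-e}\right)$ for $x,y\in[e,1]$. $A(e)=[0,1]^2\setminus([0,e]^2\cup[e,1]^2)$. A uninorm $U$ with neutral element $e$ is locally internal on $A(e)$ if $U(x,y)\in\{x,y\}$ for all $(x,y)\in A(e)$. A uninorm $V_1$ is distributive over a uninorm $V_2$ (t-norms and t-conorms being included among uninorms) if $V_1(x,V_2(y,z))=V_2(V_1(x,y),V_1(x,z))$ for all $x,y,z\in[0,1]$. $[a,b[$ and $]a,b]$ denote half-open intervals, and $]a,b[$ denotes the open interval. *)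

theory Defs
  imports Complex_Main
begin

text \<open>
  Binary operations on the unit interval are represented by functions on the reals of which
  only the values on \<open>{0..1} \<times> {0..1}\<close> matter: every condition below is relativised to the unit
  interval, and values outside are left unconstrained.
\<close>

definition uninorm :: "(real \<Rightarrow> real \<Rightarrow> real) \<Rightarrow> real \<Rightarrow> bool" where
  "uninorm U e \<longleftrightarrow>
     (\<forall>x\<in>{0..1}. \<forall>y\<in>{0..1}. U x y \<in> {0..1}) \<and>
     (\<forall>x\<in>{0..1}. \<forall>y\<in>{0..1}. U x y = U y x) \<and>
     (\<forall>x\<in>{0..1}. \<forall>y\<in>{0..1}. \<forall>z\<in>{0..1}. U (U x y) z = U x (U y z)) \<and>
     (\<forall>x\<in>{0..1}. \<forall>x'\<in>{0..1}. \<forall>y\<in>{0..1}. x \<le> x' \<longrightarrow> U x y \<le> U x' y \<and> U y x \<le> U y x') \<and>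
     e \<in> {0..1} \<and>
     (\<forall>x\<in>{0..1}. U e x = x \<and> U x e = x)"

definition tnorm :: "(real \<Rightarrow> real \<Rightarrow> real) \<Rightarrow> bool" where
  "tnorm T \<longleftrightarrow> uninorm T 1"

definition tconorm :: "(real \<Rightarrow> real \<Rightarrow> real) \<Rightarrow> bool" where
  "tconorm S \<longleftrightarrow> uninorm S 0"

text \<open>\<open>uninorm_with U T e S\<close> is the relation \<open>U \<equiv> \<langle>T, e, S\<rangle>\<close>.\<close>

definition uninorm_with ::
  "(real \<Rightarrow> real \<Rightarrow> real) \<Rightarrow> (real \<Rightarrow> real \<Rightarrow> real) \<Rightarrow> real \<Rightarrow> (real \<Rightarrow> real \<Rightarrow> real) \<Rightarrow> bool" where
  "uninorm_with U T e S \<longleftrightarrow>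
     e \<in> {0<..<1} \<and> uninorm U e \<and> tnorm T \<and> tconorm S \<and>
     (\<forall>x\<in>{0..e}. \<forall>y\<in>{0..e}. U x y = e * T (x / e) (y / e)) \<and>
     (\<forall>x\<in>{e..1}. \<forall>y\<in>{e..1}.
        U x y = e + (1 - e) * S ((x - e) / (1 - e)) ((y - e) / (1 - e)))"

definition A :: "real \<Rightarrow> (real \<times> real) set" where
  "A e = {0..1} \<times> {0..1} - ({0..e} \<times> {0..e} \<union> {e..1} \<times> {e..1})"

definition locally_internal_on_A :: "(real \<Rightarrow> real \<Rightarrow> real) \<Rightarrow> real \<Rightarrow> bool" where
  "locally_internal_on_A U e \<longleftrightarrow> (\<forall>(x, y) \<in> A e. U x y \<in> {x, y})"

definition distributive_over ::
  "(real \<Rightarrow> real \<Rightarrow> real) \<Rightarrow> (real \<Rightarrow> real \<Rightarrow> real) \<Rightarrow> bool" where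
  "distributive_over V1 V2 \<longleftrightarrow>
     (\<forall>x\<in>{0..1}. \<forall>y\<in>{0..1}. \<forall>z\<in>{0..1}. V1 x (V2 y z) = V2 (V1 x y) (V1 x z))"

end

theory Submission
  imports Defs
begin

text \<open>
  The idea is to compare the two operations with the two neutral elements.

  Suppose that \<open>U1\<close> is distributive over \<open>U2\<close>. As \<open>e2\<close> is neutral for
  \<open>U2\<close> and \<open>e1\<close> for \<open>U1\<close>, distributing \<open>x\<close> over \<open>U2 e2 e1 =
  e1\<close> gives the absorption law \<open>x = U2 (U1 x e2) x\<close>. It shows that multiplication by
  \<open>e2\<close> fixes \<open>[0, e2]\<close> pointwise, because \<open>U2\<close> is the minimum there; by
  monotonicity, \<open>U1 x y = x\<close> for \<open>x \<le> e2 \<le> y \<le> e1\<close>. In particular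
  \<open>e2\<close> is idempotent for \<open>U1\<close>, so \<open>[e2, 1]\<close> is closed under \<open>U1\<close>
  as well as under \<open>U2\<close>, and carries rescaled copies of both; this is the third condition. On the mixed
  region \<open>[0, e2[ \<times> [e2, 1]\<close> the operation \<open>U2\<close> only selects one of its arguments,
  and distributing over \<open>U2 x e1 = x\<close> and \<open>U2 e2 y = y\<close> forces \<open>U1\<close> to select
  the same one (\<open>U1_eq_U2_below_upper\<close>).

  Conversely, the conditions say that the two operations agree on the mixed region, where \<open>U2\<close> is a
  selection, that \<open>U2\<close> is a minimum below \<open>e2\<close>, and that distributivity already holds on
  \<open>[e2, 1]\<close>. If all three entries lie below \<open>e2\<close>, monotonicity of \<open>U1\<close>
  suffices. Any other triple with an entry below \<open>e2\<close> is handled by replacing \<open>U2\<close> by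
  \<open>U1\<close>, or conversely, at pairs of the mixed region, so that the equation follows from associativity and
  commutativity, together with idempotency of the repeated argument. Below \<open>e2\<close> every element is
  idempotent for \<open>U2\<close>. The delicate triples are those in which an entry above \<open>e2\<close> absorbs
  one below \<open>e2\<close>: such an entry is larger than \<open>e1\<close>, and the idempotency clause of the first
  condition is what makes it idempotent for \<open>U2\<close> (\<open>distrib_high_low_high\<close>).
\<close>

section \<open>Uninorms and their affine copies on upper subintervals\<close>

lemma uninorm_closed:
  "\<lbrakk>uninorm U e; x \<in> {0..1}; y \<in> {0..1}\<rbrakk> \<Longrightarrow> U x y \<in> {0..1}"
  unfolding uninorm_def by blast

lemma uninorm_commute:
  "\<lbrakk>uninorm U e; x \<in> {0..1}; y \<in> {0..1}\<rbrakk> \<Longrightarrow> U x y = U y x"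
  unfolding uninorm_def by blast

lemma uninorm_assoc:
  "\<lbrakk>uninorm U e; x \<in> {0..1}; y \<in> {0..1}; z \<in> {0..1}\<rbrakk> \<Longrightarrow> U (U x y) z = U x (U y z)"
  unfolding uninorm_def by blast

lemma uninorm_neutral:
  "\<lbrakk>uninorm U e; x \<in> {0..1}\<rbrakk> \<Longrightarrow> U e x = x \<and> U x e = x"
  unfolding uninorm_def by blast

lemma uninorm_unit_in:
  "uninorm U e \<Longrightarrow> e \<in> {0..1}"
  unfolding uninorm_def by blast

lemma uninorm_mono:
  assumes "uninorm U e" "x \<in> {0..1}" "x' \<in> {0..1}" "y \<in> {0..1}" "y' \<in> {0..1}" "x \<le> x'" "y \<le> y'"
  shows "U x y \<le> U x' y'"
proof -
  have "U x y \<le> U x' y" "U x' y \<le> U x' y'"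
    using assms unfolding uninorm_def by blast+
  then show ?thesis by linarith
qed

lemma uninorm_left_commute:
  assumes U: "uninorm U e" and mem: "x \<in> {0..1}" "y \<in> {0..1}" "z \<in> {0..1}"
  shows "U x (U y z) = U y (U x z)"
  using uninorm_assoc[OF U mem] uninorm_assoc[OF U mem(2,1,3)] uninorm_commute[OF U mem(1,2)]
  by simp

lemma uninorm_idem_distrib:
  assumes U: "uninorm U e" and mem: "x \<in> {0..1}" "y \<in> {0..1}" "z \<in> {0..1}" and idem: "U x x = x"
  shows "U x (U y z) = U (U x y) (U x z)"
proof -
  have "U x (U y z) = U (U x x) (U y z)" using idem by simp
  also have "\<dots> = U x (U y (U x z))"
    using uninorm_assoc[OF U mem(1,1), of "U y z"] uninorm_left_commute[OF U mem]
      uninorm_closed[OF U mem(2,3)] by simp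
  also have "\<dots> = U (U x y) (U x z)"
    using uninorm_assoc[OF U mem(1,2), of "U x z"] uninorm_closed[OF U mem(1,3)] by simp
  finally show ?thesis .
qed

text \<open>The affine copy on the unit interval of an operation on \<open>[e, 1]\<close>.\<close>

definition rescale_upper :: "real \<Rightarrow> (real \<Rightarrow> real \<Rightarrow> real) \<Rightarrow> real \<Rightarrow> real \<Rightarrow> real" where
  "rescale_upper e U x y = (U (e + (1 - e) * x) (e + (1 - e) * y) - e) / (1 - e)"

lemma upper_affine_mem:
  fixes e t :: real
  assumes "e < 1" "t \<in> {0..1}"
  shows "e + (1 - e) * t \<in> {e..1}"
proof -
  have "(1 - e) * t \<le> (1 - e) * 1" "0 \<le> (1 - e) * t"
    using assms by (intro mult_left_mono mult_nonneg_nonneg; simp)+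
  then show ?thesis by simp
qed

lemma upper_affine_mem_inverse:
  fixes e x :: real
  assumes "e < 1" "x \<in> {e..1}"
  shows "(x - e) / (1 - e) \<in> {0..1}"
  using assms by (simp add: divide_simps)

lemma upper_affine_inverse:
  fixes e x :: real
  assumes "e < 1"
  shows "e + (1 - e) * ((x - e) / (1 - e)) = x"
  using assms by simp

lemma rescale_upper_scale_back:
  assumes "e < 1"
  shows "U x y = e + (1 - e) * rescale_upper e U ((x - e) / (1 - e)) ((y - e) / (1 - e))"
  using assms by (simp add: rescale_upper_def)

text \<open>
  Idempotency of \<open>e\<close> makes \<open>[e, 1]\<close> closed under the operation, by monotonicity.
\<close>

lemma uninorm_closed_upper:
  assumes "uninorm U a" "e \<in> {0..1}" "U e e = e" "x \<in> {e..1}" "y \<in> {e..1}"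
  shows "U x y \<in> {e..1}"
  using uninorm_mono[OF assms(1), of e x e y] uninorm_closed[OF assms(1), of x y] assms by auto

lemma uninorm_rescale_upper:
  assumes U: "uninorm U a" and e: "0 \<le> e" "e < 1" and idem: "U e e = e" and a: "e \<le> a"
  shows "uninorm (rescale_upper e U) ((a - e) / (1 - e))"
proof -
  let ?f = "\<lambda>t. e + (1 - e) * t"
  let ?R = "rescale_upper e U"
  have f: "?f t \<in> {e..1}" if "t \<in> {0..1}" for t
    using upper_affine_mem[OF e(2) that] .
  have f01: "?f t \<in> {0..1}" if "t \<in> {0..1}" for t
    using f[OF that] e by auto
  have U_up: "U (?f x) (?f y) \<in> {e..1}" if "x \<in> {0..1}" "y \<in> {0..1}" for x y
    using uninorm_closed_upper[OF U _ idem f[OF that(1)] f[OF that(2)]] e by simp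
  have closed: "?R x y \<in> {0..1}" if "x \<in> {0..1}" "y \<in> {0..1}" for x y
    using upper_affine_mem_inverse[OF e(2) U_up[OF that]] by (simp add: rescale_upper_def)
  have fR: "?f (?R x y) = U (?f x) (?f y)" for x y
    using e by (simp add: rescale_upper_def)
  have assoc: "?R (?R x y) z = ?R x (?R y z)"
    if "x \<in> {0..1}" "y \<in> {0..1}" "z \<in> {0..1}" for x y z
  proof -
    have "U (?f (?R x y)) (?f z) = U (?f x) (?f (?R y z))"
      unfolding fR using uninorm_assoc[OF U] that f01 by blast
    then show ?thesis unfolding rescale_upper_def[of e U "?R x y" z]
        rescale_upper_def[of e U x "?R y z"] by simp
  qed
  have mono: "?R x y \<le> ?R x' y'"
    if "x \<in> {0..1}" "x' \<in> {0..1}" "y \<in> {0..1}" "y' \<in> {0..1}" "x \<le> x'" "y \<le> y'" for x x' y y'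
  proof -
    have "U (?f x) (?f y) \<le> U (?f x') (?f y')"
      using that e by (intro uninorm_mono[OF U] f01) (auto intro: mult_left_mono)
    then show ?thesis using e by (simp add: rescale_upper_def divide_right_mono)
  qed
  have fa: "?f ((a - e) / (1 - e)) = a"
    using e(2) by (rule upper_affine_inverse)
  have neutral: "?R ((a - e) / (1 - e)) x = x" "?R x ((a - e) / (1 - e)) = x"
    if "x \<in> {0..1}" for x
    unfolding rescale_upper_def fa using uninorm_neutral[OF U f01[OF that]] e by simp_all
  have "(a - e) / (1 - e) \<in> {0..1}"
    using upper_affine_mem_inverse[OF e(2)] a uninorm_unit_in[OF U] by auto
  moreover have "?R x y = ?R y x" if "x \<in> {0..1}" "y \<in> {0..1}" for x y
    using uninorm_commute[OF U f01[OF that(1)] f01[OF that(2)]] by (simp add: rescale_upper_def)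
  ultimately show ?thesis
    unfolding uninorm_def using closed assoc mono neutral by simp
qed

text \<open>
  An affine bijection onto the unit interval transports both operations, so distributivity
  on \<open>[e, 1]\<close> may be tested on the copies.
\<close>

lemma distributive_over_upper_iff:
  assumes e: "e < 1"
    and V1: "\<And>x y. x \<in> {e..1} \<Longrightarrow> y \<in> {e..1} \<Longrightarrow>
      V1 x y = e + (1 - e) * W1 ((x - e) / (1 - e)) ((y - e) / (1 - e))"
    and V2: "\<And>x y. x \<in> {e..1} \<Longrightarrow> y \<in> {e..1} \<Longrightarrow>
      V2 x y = e + (1 - e) * W2 ((x - e) / (1 - e)) ((y - e) / (1 - e))"
    and W1: "\<And>x y. x \<in> {0..1} \<Longrightarrow> y \<in> {0..1} \<Longrightarrow> W1 x y \<in> {0..1}"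
    and W2: "\<And>x y. x \<in> {0..1} \<Longrightarrow> y \<in> {0..1} \<Longrightarrow> W2 x y \<in> {0..1}"
  shows "distributive_over W1 W2 \<longleftrightarrow>
    (\<forall>x\<in>{e..1}. \<forall>y\<in>{e..1}. \<forall>z\<in>{e..1}. V1 x (V2 y z) = V2 (V1 x y) (V1 x z))"
proof -
  let ?f = "\<lambda>t. e + (1 - e) * t"
  let ?g = "\<lambda>x. (x - e) / (1 - e)"
  have gf: "?g (?f t) = t" for t
    using e by simp
  have fg: "?f (?g x) = x" for x
    using e by simp
  have V1f: "V1 (?f s) (?f t) = ?f (W1 s t)" if "s \<in> {0..1}" "t \<in> {0..1}" for s t
    using V1[OF upper_affine_mem[OF e that(1)] upper_affine_mem[OF e that(2)]] by (simp only: gf)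
  have V2f: "V2 (?f s) (?f t) = ?f (W2 s t)" if "s \<in> {0..1}" "t \<in> {0..1}" for s t
    using V2[OF upper_affine_mem[OF e that(1)] upper_affine_mem[OF e that(2)]] by (simp only: gf)
  have inst: "W1 r (W2 s t) = W2 (W1 r s) (W1 r t) \<longleftrightarrow>
      V1 (?f r) (V2 (?f s) (?f t)) = V2 (V1 (?f r) (?f s)) (V1 (?f r) (?f t))"
    if "r \<in> {0..1}" "s \<in> {0..1}" "t \<in> {0..1}" for r s t
    using that e by (simp only: V1f V2f W1 W2) simp
  show ?thesis
  proof
    assume D: "distributive_over W1 W2"
    show "\<forall>x\<in>{e..1}. \<forall>y\<in>{e..1}. \<forall>z\<in>{e..1}. V1 x (V2 y z) = V2 (V1 x y) (V1 x z)"
    proof (intro ballI)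
      fix x y z assume "x \<in> {e..1}" "y \<in> {e..1}" "z \<in> {e..1}"
      then have g: "?g x \<in> {0..1}" "?g y \<in> {0..1}" "?g z \<in> {0..1}"
        using upper_affine_mem_inverse[OF e] by blast+
      then have "W1 (?g x) (W2 (?g y) (?g z)) = W2 (W1 (?g x) (?g y)) (W1 (?g x) (?g z))"
        using D unfolding distributive_over_def by blast
      then show "V1 x (V2 y z) = V2 (V1 x y) (V1 x z)"
        using inst[OF g] unfolding fg by blast
    qed
  next
    assume "\<forall>x\<in>{e..1}. \<forall>y\<in>{e..1}. \<forall>z\<in>{e..1}. V1 x (V2 y z) = V2 (V1 x y) (V1 x z)"
    then show "distributive_over W1 W2"
      unfolding distributive_over_def using inst upper_affine_mem[OF e] by blast
  qed
qed

section \<open>Two uninorms with ordered neutral elements\<close>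

locale uninorm_pair =
  fixes U1 U2 :: "real \<Rightarrow> real \<Rightarrow> real" and e1 e2 :: real
  assumes e2_pos: "0 < e2" and e2_less_e1: "e2 < e1" and e1_less_1: "e1 < 1"
    and U1: "uninorm U1 e1" and U2: "uninorm U2 e2"
    and U2_min: "\<And>x y. x \<in> {0..e2} \<Longrightarrow> y \<in> {0..e2} \<Longrightarrow> U2 x y = min x y"
    and U2_internal: "locally_internal_on_A U2 e2"
begin

lemmas U1_closed = uninorm_closed[OF U1]
lemmas U1_commute = uninorm_commute[OF U1]
lemmas U1_assoc = uninorm_assoc[OF U1]
lemmas U1_mono = uninorm_mono[OF U1]
lemmas U1_neutral = uninorm_neutral[OF U1]
lemmas U2_closed = uninorm_closed[OF U2]
lemmas U2_commute = uninorm_commute[OF U2]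
lemmas U2_assoc = uninorm_assoc[OF U2]
lemmas U2_mono = uninorm_mono[OF U2]
lemmas U2_neutral = uninorm_neutral[OF U2]

lemma units_in: "e1 \<in> {0..1}" "e2 \<in> {0..1}"
  using e2_pos e2_less_e1 e1_less_1 by auto

lemma U2_selects:
  assumes "x \<in> {0..<e2}" "y \<in> {e2..1}"
  shows "U2 x y = x \<or> U2 x y = y"
proof (cases "y = e2")
  case True
  then show ?thesis using assms U2_neutral[of x] units_in by auto
next
  case False
  then have "(x, y) \<in> A e2"
    using assms units_in by (auto simp: A_def)
  then show ?thesis
    using U2_internal unfolding locally_internal_on_A_def by blast
qed

lemma U2_ge_right:
  assumes "x \<in> {e2..1}" "y \<in> {0..1}"
  shows "y \<le> U2 x y"
  using U2_mono[of e2 x y y] U2_neutral[of y] assms units_in by auto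

section \<open>Consequences of distributivity\<close>

context
  assumes distrib: "distributive_over U1 U2"
begin

lemma distribD:
  assumes "x \<in> {0..1}" "y \<in> {0..1}" "z \<in> {0..1}"
  shows "U1 x (U2 y z) = U2 (U1 x y) (U1 x z)"
  using distrib assms unfolding distributive_over_def by blast

text \<open>
  Distribute \<open>x\<close> over \<open>U2 e2 e1 = e1\<close>.
\<close>

lemma absorption:
  assumes "x \<in> {0..1}"
  shows "U2 (U1 x e2) x = x"
  using distribD[of x e2 e1] U2_neutral[of e1] U1_neutral[of x] assms units_in by simp

lemma U1_e2_below:
  assumes "x \<in> {0..e2}"
  shows "U1 x e2 = x"
proof -
  have x01: "x \<in> {0..1}" using assms units_in by auto
  have "U1 x e2 \<le> x"
    using U1_mono[of x x e2 e1] U1_neutral[of x] x01 units_in e2_less_e1 by auto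
  then have "U2 (U1 x e2) x = U1 x e2"
    using U2_min[of "U1 x e2" x] U1_closed[of x e2] assms x01 units_in by auto
  then show ?thesis using absorption[OF x01] by simp
qed

lemma U1_below_middle:
  assumes "x \<in> {0..e2}" "y \<in> {e2..e1}"
  shows "U1 x y = x"
  using U1_mono[of x x e2 y] U1_mono[of x x y e1] U1_e2_below[of x] U1_neutral[of x]
    assms units_in by auto

text \<open>
  Were \<open>U2 x y\<close> equal to \<open>y\<close>, then multiplication by \<open>e2\<close>, which fixes \<open>x\<close> and
  collapses \<open>y\<close> to \<open>e2\<close>, would give \<open>e2 = U2 x e2 = x\<close>.
\<close>

lemma U2_below_middle:
  assumes "x \<in> {0..<e2}" "y \<in> {e2..e1}"
  shows "U2 x y = x"
proof (rule ccontr)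
  assume "U2 x y \<noteq> x"
  then have "U2 x y = y" using U2_selects[of x y] assms units_in by auto
  moreover have "U1 e2 y = e2" "U1 e2 x = x"
    using U1_below_middle[of e2 y] U1_e2_below[of x] U1_commute[of x e2] assms units_in by auto
  ultimately have "e2 = U2 x e2"
    using distribD[of e2 x y] assms units_in by auto
  then show False using U2_neutral[of x] assms units_in by auto
qed

text \<open>
  Write \<open>w = U1 x y\<close>. Distributing \<open>y\<close> over \<open>U2 x e1 = x\<close> gives \<open>w = U2 w y\<close>, and distributing
  \<open>x\<close> over \<open>U2 e2 y = y\<close> gives \<open>w = U2 x w\<close>. If \<open>w \<le> e2\<close>, the second equation says that
  \<open>w = min x w\<close>, hence \<open>w = x\<close>; otherwise the first one gives \<open>w = y\<close>. The same two equations then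
  show that \<open>U2\<close> makes the same choice.
\<close>

lemma U1_eq_U2_below_upper:
  assumes x: "x \<in> {0..<e2}" and y: "y \<in> {e1..1}"
  shows "U1 x y = U2 x y"
proof -
  define w where "w = U1 x y"
  have x01: "x \<in> {0..1}" and y01: "y \<in> {0..1}" and y_up: "y \<in> {e2..1}"
    using x y units_in e2_less_e1 by auto
  have w01: "w \<in> {0..1}" unfolding w_def using U1_closed x01 y01 by blast
  have x_le_w: "x \<le> w"
    unfolding w_def using U1_mono[of x x e1 y] U1_neutral[of x] x01 y01 y units_in by auto
  have w_le_y: "w \<le> y"
    unfolding w_def using U1_mono[of x e1 y y] U1_neutral[of y] x01 y01 x units_in e2_less_e1
    by auto
  have "U2 x e1 = x" using U2_below_middle[OF x, of e1] e2_less_e1 by simp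
  then have w_y: "U2 w y = w"
    using distribD[of y x e1] U1_commute[of y x] U1_neutral[of y] x01 y01 units_in w_def by simp
  have x_w: "U2 x w = w"
    using distribD[of x e2 y] U2_neutral[of y] U1_e2_below[of x] x x01 y01 units_in w_def by auto
  show ?thesis
  proof (cases "w \<le> e2")
    case True
    then have w_x: "w = x" using x_w U2_min[of x w] x x_le_w w01 by auto
    then show ?thesis using w_y w_def by simp
  next
    case False
    then have "y \<le> U2 w y" using U2_ge_right[of w y] w01 y01 by auto
    then have "w = y" using w_y w_le_y by simp
    then show ?thesis using x_w w_def by simp
  qed
qed

text \<open>
  Both \<open>U1 y x\<close> and \<open>U1 y e1\<close> are \<open>y\<close>, while \<open>U2 x e1\<close> is just \<open>x\<close>; distribute \<open>y\<close> over it.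
\<close>

lemma U2_idem_if_absorbs:
  assumes x: "x \<in> {0..<e2}" and y: "y \<in> {e1..1}" and abs: "U2 x y = y"
  shows "U2 y y = y"
proof -
  have x01: "x \<in> {0..1}" and y01: "y \<in> {0..1}"
    using x y units_in by auto
  have "U1 y x = y"
    using U1_eq_U2_below_upper[OF x y] U1_commute[of y x] abs x01 y01 by simp
  moreover have "U2 x e1 = x" using U2_below_middle[OF x, of e1] e2_less_e1 by simp
  ultimately show ?thesis
    using distribD[of y x e1] U1_neutral[of y] x01 y01 units_in by simp
qed

lemma U1_eq_U2_mixed:
  assumes "x \<in> {0..<e2}" "y \<in> {e2..1}"
  shows "U1 x y = U2 x y"
  using U1_eq_U2_below_upper[of x y] U1_below_middle[of x y] U2_below_middle[of x y] assms
  by (cases "y \<le> e1") auto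

end

section \<open>Recovering distributivity\<close>

context
  assumes agree: "\<And>x y. x \<in> {0..<e2} \<Longrightarrow> y \<in> {e2..1} \<Longrightarrow> U1 x y = U2 x y"
    and middle: "\<And>x y. x \<in> {0..<e2} \<Longrightarrow> y \<in> {e2..e1} \<Longrightarrow> U2 x y = x"
    and absorber_idem: "\<And>x y. x \<in> {0..<e2} \<Longrightarrow> y \<in> {e1..1} \<Longrightarrow> U2 x y = y \<Longrightarrow> U2 y y = y"
    and U1_e2_idem: "U1 e2 e2 = e2"
    and upper: "\<And>x y z. x \<in> {e2..1} \<Longrightarrow> y \<in> {e2..1} \<Longrightarrow> z \<in> {e2..1} \<Longrightarrow>
      U1 x (U2 y z) = U2 (U1 x y) (U1 x z)"
begin

text \<open>
  An element of \<open>[e2, 1]\<close> absorbing some \<open>x < e2\<close> cannot lie in \<open>[e2, e1]\<close>, where \<open>U2\<close> selects \<open>x\<close>.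
\<close>

lemma absorber:
  assumes "x \<in> {0..<e2}" "y \<in> {e2..1}" "U2 x y = y"
  shows "e1 < y" "U2 y y = y"
proof -
  show "e1 < y" using middle[of x y] assms by (cases "y \<le> e1") auto
  then show "U2 y y = y" using absorber_idem[of x y] assms by auto
qed

lemma U1_upper_closed:
  "\<lbrakk>x \<in> {e2..1}; y \<in> {e2..1}\<rbrakk> \<Longrightarrow> U1 x y \<in> {e2..1}"
  using uninorm_closed_upper[OF U1 units_in(2) U1_e2_idem] .

lemma U2_upper_closed:
  "\<lbrakk>x \<in> {e2..1}; y \<in> {e2..1}\<rbrakk> \<Longrightarrow> U2 x y \<in> {e2..1}"
  using uninorm_closed_upper[OF U2 units_in(2)] U2_neutral[OF units_in(2)] by blast

lemma U1_low_le:
  assumes "x \<in> {0..<e2}" "y \<in> {0..<e2}"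
  shows "U1 x y \<in> {0..<e2}" "U1 x y \<le> x" "U1 x y \<le> y"
proof -
  show "U1 x y \<le> x"
    using U1_mono[of x x y e1] U1_neutral[of x] assms units_in e2_less_e1 by auto
  then show "U1 x y \<in> {0..<e2}"
    using U1_closed[of x y] assms units_in by auto
  show "U1 x y \<le> y"
    using U1_mono[of x e1 y y] U1_neutral[of y] assms units_in e2_less_e1 by auto
qed

lemma distrib_low_low_low:
  assumes x: "x \<in> {0..<e2}" and y: "y \<in> {0..<e2}" and z: "z \<in> {0..<e2}" and "y \<le> z"
  shows "U1 x (U2 y z) = U2 (U1 x y) (U1 x z)"
proof -
  have "U2 y z = y" using U2_min[of y z] assms by auto
  moreover have "U1 x y \<le> U1 x z" using U1_mono[of x x y z] assms units_in by auto
  then have "U2 (U1 x y) (U1 x z) = U1 x y"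
    using U2_min[of "U1 x y" "U1 x z"] U1_low_le(1)[OF x y] U1_low_le(1)[OF x z] by auto
  ultimately show ?thesis by simp
qed

lemma distrib_low_low_high:
  assumes x: "x \<in> {0..<e2}" and y: "y \<in> {0..<e2}" and z: "z \<in> {e2..1}"
  shows "U1 x (U2 y z) = U2 (U1 x y) (U1 x z)"
proof -
  have mem: "x \<in> {0..1}" "y \<in> {0..1}" "z \<in> {0..1}" using x y z units_in by auto
  note low = U1_low_le[OF x y]
  have xz: "U1 x z = U2 x z" and yz: "U1 y z = U2 y z" using agree x y z by blast+
  \<comment> \<open>By associativity of \<open>U1\<close>, whichever argument \<open>U2 y z\<close> selects.\<close>
  have assoc: "U2 (U1 x y) z = U1 x (U2 y z)"
    using agree[OF low(1) z] U1_assoc[OF mem] yz by simp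
  have xy_min: "U2 (U1 x y) x = U1 x y"
    using U2_min[of "U1 x y" x] low x by auto
  from U2_selects[OF x z] show ?thesis
  proof
    assume "U2 x z = z"
    then show ?thesis using assoc xz by simp
  next
    assume x_sel: "U2 x z = x"
    then have "U2 (U1 x y) z = U1 x y"
      using U1_assoc[of y x z] U1_commute[of x y] agree[OF low(1) z] xz mem by simp
    then show ?thesis using assoc xz x_sel xy_min by simp
  qed
qed

text \<open>
  With \<open>x < e2 \<le> y, z\<close> all occurrences of \<open>U1\<close> may be replaced by \<open>U2\<close>, and what remains is
  idempotency of \<open>x\<close>.
\<close>

lemma distrib_low_high_high:
  assumes x: "x \<in> {0..<e2}" and y: "y \<in> {e2..1}" and z: "z \<in> {e2..1}"
  shows "U1 x (U2 y z) = U2 (U1 x y) (U1 x z)"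
proof -
  have mem: "x \<in> {0..1}" "y \<in> {0..1}" "z \<in> {0..1}" using x y z units_in by auto
  have "U2 x x = x" using U2_min[of x x] x by auto
  then have "U2 x (U2 y z) = U2 (U2 x y) (U2 x z)"
    using uninorm_idem_distrib[OF U2 mem] by blast
  then show ?thesis
    using agree[OF x y] agree[OF x z] agree[OF x U2_upper_closed[OF y z]] by simp
qed

text \<open>
  The factor \<open>x\<close> occurs twice on the right. This is harmless if \<open>x\<close> is idempotent for \<open>U2\<close>, hence
  if it absorbs \<open>y\<close> or \<open>z\<close>; if it absorbs neither, it acts on both of them as an identity.
\<close>

lemma distrib_high_low_low:
  assumes x: "x \<in> {e2..1}" and y: "y \<in> {0..<e2}" and z: "z \<in> {0..<e2}"
  shows "U1 x (U2 y z) = U2 (U1 x y) (U1 x z)"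
proof -
  have mem: "x \<in> {0..1}" "y \<in> {0..1}" "z \<in> {0..1}" using x y z units_in by auto
  have U1_U2: "U1 x t = U2 x t" if "t \<in> {0..<e2}" for t
    using agree[OF that x] U1_commute[of x t] U2_commute[of x t] that mem units_in by auto
  have yz: "U2 y z = min y z" using U2_min[of y z] y z by auto
  have lhs: "U1 x (U2 y z) = U2 x (U2 y z)"
    using U1_U2[of "U2 y z"] yz y z by auto
  show ?thesis
  proof (cases "U2 y x = x \<or> U2 z x = x")
    case True
    then have "U2 x x = x" using absorber(2) x y z by blast
    then have "U2 x (U2 y z) = U2 (U2 x y) (U2 x z)"
      using uninorm_idem_distrib[OF U2 mem] by blast
    then show ?thesis using lhs U1_U2 y z by simp
  next
    case False
    then have "U2 x y = y" "U2 x z = z"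
      using U2_selects[OF y x] U2_selects[OF z x] U2_commute[of x y] U2_commute[of x z] mem by auto
    then show ?thesis using lhs U1_U2 y z yz by (simp add: min_def)
  qed
qed

text \<open>
  If \<open>x\<close> does not absorb \<open>y\<close>, associativity of \<open>U1\<close> suffices. If it does, then \<open>e1 < x\<close>, and \<open>x\<close>
  is idempotent for \<open>U2\<close>; what has to be shown is \<open>U1 x (U2 y z) = U2 x (U1 x z)\<close>.
\<close>

lemma distrib_high_low_high:
  assumes x: "x \<in> {e2..1}" and y: "y \<in> {0..<e2}" and z: "z \<in> {e2..1}"
  shows "U1 x (U2 y z) = U2 (U1 x y) (U1 x z)"
proof -
  have mem: "x \<in> {0..1}" "y \<in> {0..1}" "z \<in> {0..1}" using x y z units_in by auto
  have xy: "U1 x y = U2 y x" using agree[OF y x] U1_commute[of x y] mem by simp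
  have yz: "U1 y z = U2 y z" using agree[OF y z] .
  have xz_up: "U1 x z \<in> {e2..1}" using U1_upper_closed[OF x z] .
  from U2_selects[OF y x] show ?thesis
  proof
    assume "U2 y x = y"
    then have "U2 (U1 x y) (U1 x z) = U1 y (U1 x z)"
      using xy agree[OF y xz_up] by simp
    also have "\<dots> = U1 x (U1 y z)"
      using uninorm_left_commute[OF U1 mem(2,1,3)] .
    finally show ?thesis using yz by simp
  next
    assume abs: "U2 y x = x"
    note x_abs = absorber[OF y x abs]
    from U2_selects[OF y z] show ?thesis
    proof
      assume y_sel: "U2 y z = y"
      \<comment> \<open>Then \<open>x\<close> absorbs \<open>z\<close> for \<open>U1\<close> as well, since \<open>U1 x z = U1 (U1 x y) z = U1 x (U1 y z)\<close>.\<close>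
      have "U1 x z = x"
        using U1_assoc[of x y z] mem xy yz abs y_sel by simp
      then show ?thesis using xy abs y_sel x_abs(2) by simp
    next
      assume z_abs: "U2 y z = z"
      note z_idem = absorber[OF y z z_abs]
      \<comment> \<open>Writing the outer \<open>x\<close> of \<open>U2 x (U1 x z)\<close> as \<open>U1 x e1\<close> makes distributivity on \<open>[e2, 1]\<close>
        applicable, and \<open>U2 e1 z\<close> lies between \<open>z\<close> and \<open>U2 z z = z\<close>.\<close>
      have "U2 e1 z = z"
        using U2_ge_right[of e1 z] U2_mono[of e1 z z z] z_idem mem units_in e2_less_e1 by auto
      then have "U1 x z = U2 x (U1 x z)"
        using upper[OF x, of e1 z] z U1_neutral[of x] mem units_in e2_less_e1 by auto
      then show ?thesis using xy abs z_abs by simp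
    qed
  qed
qed

lemma distrib_ordered:
  assumes "x \<in> {0..1}" "y \<in> {0..1}" "z \<in> {0..1}" "y \<le> z"
  shows "U1 x (U2 y z) = U2 (U1 x y) (U1 x z)"
proof -
  have split: "t \<in> {0..<e2} \<or> t \<in> {e2..1}" if "t \<in> {0..1}" for t
    using that by auto
  have "(y \<in> {0..<e2} \<and> z \<in> {0..<e2}) \<or> (y \<in> {0..<e2} \<and> z \<in> {e2..1}) \<or>
      (y \<in> {e2..1} \<and> z \<in> {e2..1})"
    using assms by auto
  then show ?thesis
    using split[OF assms(1)] assms(4) distrib_low_low_low distrib_low_low_high
      distrib_low_high_high distrib_high_low_low distrib_high_low_high upper by blast
qed

lemma distributive_from_conditions: "distributive_over U1 U2"
  unfolding distributive_over_def
proof (intro ballI)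
  fix x y z :: real
  assume mem: "x \<in> {0..1}" "y \<in> {0..1}" "z \<in> {0..1}"
  show "U1 x (U2 y z) = U2 (U1 x y) (U1 x z)"
  proof (cases "y \<le> z")
    case True
    then show ?thesis using distrib_ordered mem by blast
  next
    case False
    then have "U1 x (U2 z y) = U2 (U1 x z) (U1 x y)"
      using distrib_ordered mem by simp
    then show ?thesis
      using U2_commute[of y z] U2_commute[of "U1 x y" "U1 x z"] U1_closed[of x y] U1_closed[of x z]
        mem by simp
  qed
qed

end

end

lemma uninorm_pair_of_uninorm_with:
  assumes "0 < e2" "e2 < e1" "e1 < 1"
    and U1: "uninorm_with U1 T1 e1 S1" and U2: "uninorm_with U2 min e2 S2"
    and int: "locally_internal_on_A U2 e2"
  shows "uninorm_pair U1 U2 e1 e2"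
proof
  fix x y assume "x \<in> {0..e2}" "y \<in> {0..e2}"
  then have "U2 x y = e2 * min (x / e2) (y / e2)"
    using U2 unfolding uninorm_with_def by blast
  then show "U2 x y = min x y"
    using \<open>0 < e2\<close> by (simp add: min_def divide_le_cancel)
qed (use assms in \<open>auto simp: uninorm_with_def\<close>)

section \<open>The characterisation\<close>

theorem theorem2:
  fixes e1 e2 :: real
    and U1 U2 T1 S1 S2 :: "real \<Rightarrow> real \<Rightarrow> real"
  assumes "0 < e2" and "e2 < e1" and "e1 < 1"
    and "uninorm_with U1 T1 e1 S1"
    and "uninorm_with U2 min e2 S2"
    and "locally_internal_on_A U2 e2"
  shows "distributive_over U1 U2 \<longleftrightarrow>
    ((\<forall>x\<in>{0..<e2}. \<forall>y\<in>{e2..1}. U1 x y = U2 x y \<and> U2 x y \<in> {x, y}) \<and>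
     (\<forall>y0\<in>{e1..1}. (\<exists>x0\<in>{0..<e2}. U2 x0 y0 = y0) \<longrightarrow> U2 y0 y0 = y0)) \<and>
    (\<forall>x\<in>{0..<e2}. \<forall>y\<in>{e2..e1}. U1 x y = U2 x y \<and> U2 x y = min x y) \<and>
    (\<exists>U. uninorm U ((e1 - e2) / (1 - e2)) \<and>
       (\<forall>x\<in>{e2..1}. \<forall>y\<in>{e2..1}.
          U1 x y = e2 + (1 - e2) * U ((x - e2) / (1 - e2)) ((y - e2) / (1 - e2))) \<and>
       distributive_over U S2)"
proof -
  interpret uninorm_pair U1 U2 e1 e2
    using uninorm_pair_of_uninorm_with[OF assms] .
  have e2: "e2 < 1" using \<open>e2 < e1\<close> \<open>e1 < 1\<close> by linarith
  have U2_S2: "U2 x y = e2 + (1 - e2) * S2 ((x - e2) / (1 - e2)) ((y - e2) / (1 - e2))"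
    if "x \<in> {e2..1}" "y \<in> {e2..1}" for x y
    using assms(5) that unfolding uninorm_with_def by blast
  have S2: "S2 x y \<in> {0..1}" if "x \<in> {0..1}" "y \<in> {0..1}" for x y
    using assms(5) that uninorm_closed unfolding uninorm_with_def tconorm_def by blast
  show ?thesis (is "_ \<longleftrightarrow> (?select \<and> ?idem) \<and> ?middle \<and> ?upper")
  proof
    assume D: "distributive_over U1 U2"
    have ?select
      using U1_eq_U2_mixed[OF D] U2_selects by blast
    moreover have ?idem
      using U2_idem_if_absorbs[OF D] by blast
    moreover have ?middle
      using U1_eq_U2_mixed[OF D] U2_below_middle[OF D] \<open>e1 < 1\<close> by (auto simp: min_def)
    moreover have ?upper
    proof (intro exI conjI)
      let ?R = "rescale_upper e2 U1"
      have idem: "U1 e2 e2 = e2" using U1_e2_below[OF D, of e2] e2_pos by simp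
      show R: "uninorm ?R ((e1 - e2) / (1 - e2))"
        using uninorm_rescale_upper[OF U1 _ e2 idem] e2_pos e2_less_e1 by simp
      show "\<forall>x\<in>{e2..1}. \<forall>y\<in>{e2..1}.
          U1 x y = e2 + (1 - e2) * ?R ((x - e2) / (1 - e2)) ((y - e2) / (1 - e2))"
        using rescale_upper_scale_back[OF e2] by blast
      have "\<forall>x\<in>{e2..1}. \<forall>y\<in>{e2..1}. \<forall>z\<in>{e2..1}. U1 x (U2 y z) = U2 (U1 x y) (U1 x z)"
        using distribD[OF D] e2_pos by simp
      then show "distributive_over ?R S2"
        using distributive_over_upper_iff[of e2 U1 ?R U2 S2] e2 rescale_upper_scale_back[OF e2]
          U2_S2 uninorm_closed[OF R] S2 by blast
    qed
    ultimately show "(?select \<and> ?idem) \<and> ?middle \<and> ?upper" by blast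
  next
    assume conds: "(?select \<and> ?idem) \<and> ?middle \<and> ?upper"
    then obtain U where U: "uninorm U ((e1 - e2) / (1 - e2))"
      and U1_U: "\<And>x y. x \<in> {e2..1} \<Longrightarrow> y \<in> {e2..1} \<Longrightarrow>
        U1 x y = e2 + (1 - e2) * U ((x - e2) / (1 - e2)) ((y - e2) / (1 - e2))"
      and D: "distributive_over U S2"
      by blast
    have upper: "\<forall>x\<in>{e2..1}. \<forall>y\<in>{e2..1}. \<forall>z\<in>{e2..1}. U1 x (U2 y z) = U2 (U1 x y) (U1 x z)"
      using distributive_over_upper_iff[of e2 U1 U U2 S2] e2 U1_U U2_S2 uninorm_closed[OF U] S2 D
      by blast
    \<comment> \<open>At least \<open>e2\<close> because \<open>U\<close> is non-negative, at most \<open>U1 e2 e1\<close> by monotonicity.\<close>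
    have idem: "U1 e2 e2 = e2"
    proof (rule antisym)
      show "U1 e2 e2 \<le> e2"
        using U1_mono[of e2 e2 e2 e1] U1_neutral[of e2] units_in e2_less_e1 by simp
      show "e2 \<le> U1 e2 e2"
        using U1_U[of e2 e2] uninorm_closed[OF U, of 0 0] e2 by simp
    qed
    show "distributive_over U1 U2"
    proof (rule distributive_from_conditions[OF _ _ _ idem])
      fix x y assume "x \<in> {0..<e2}" "y \<in> {e2..1}"
      then show "U1 x y = U2 x y" using conds by blast
    next
      fix x y assume "x \<in> {0..<e2}" "y \<in> {e2..e1}"
      then show "U2 x y = x" using conds by (auto simp: min_def)
    next
      fix x y assume "x \<in> {0..<e2}" "y \<in> {e1..1}" "U2 x y = y"
      then show "U2 y y = y" using conds by blast
    next
      fix x y z assume "x \<in> {e2..1}" "y \<in> {e2..1}" "z \<in> {e2..1}"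
      then show "U1 x (U2 y z) = U2 (U1 x y) (U1 x z)" using upper by blast
    qed
  qed
qed

end
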